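(* (1) Let $n=p_1^{n_1}p_2^{n_2}$, where $p_1,p_2$ are distinct odd primes and $n_1,n_2\geq 1$ are integers, and let $C_2(H)$ be the binary code generated by an incidence matrix $H$ of the unit graph $G(\mathbb{Z}_n)$. Then the dual code $C_2(H)^{\perp}$ is a $\left[\frac{(n-1)\phi(n)}{2},\,\frac{(n-1)[\phi(n)-2]}{2},\,3\right]_{2}$ code. (2) Let $n=2^{m}p_1^{n_1}\neq 6$, where $p_1$ is an odd prime and $m,n_1\geq 1$ are integers, let $q$ be an odd prime, and let $C_q(H)$ be the $q$-ary code generated by an incidence matrix $H$ of the unit graph $G(\mathbb{Z}_n)$. Then the dual code $C_q(H)^{\perp}$ is a $\left[\frac{n\phi(n)}{2},\,\frac{n(\phi(n)-2)+2}{2},\,4\right]_{q}$ code.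
   Context: The unit graph $G(\mathbb{Z}_n)$ is the simple graph with vertex set $\mathbb{Z}_n$ in which two distinct vertices $x,y$ are adjacent iff $x+y$ is a unit of $\mathbb{Z}_n$. An incidence matrix of a graph $(V,E)$ has rows indexed by vertices and columns by edges, with entry $1$ if the vertex is an endpoint of the edge and $0$ otherwise. For a prime $q$, $C_q(H)$ denotes the $\mathbb{F}_q$-span of the rows of $H$ (entries read in $\mathbb{F}_q$), a subspace of $\mathbb{F}_q^{|E|}$. The dual $C^\perp$ of a code $C\subseteq\mathbb{F}_q^N$ is its orthogonal complement with respect to the standard bilinear form. An $[N,k,d]_q$ code is a linear subspace of $\mathbb{F}_q^N$ of dimension $k$ whose minimum Hamming weight of nonzero vectors (equivalently, minimum distance) is $d$. $\phi$ is Euler's totient function. *)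

theory Defs
  imports
    "Jordan_Normal_Form.VS_Connect"
    "Berlekamp_Zassenhaus.Finite_Field"
    "HOL-Number_Theory.Residues"
begin

text \<open>A simple graph is a pair of a vertex set and a set of edges, each edge being the
  two-element set of its endpoints.\<close>

type_synonym 'v graph = "'v set \<times> 'v set set"

definition unit_graph :: "('v, 'm) ring_scheme \<Rightarrow> 'v graph" where
  "unit_graph R = (carrier R,
     {{x, y} | x y. x \<in> carrier R \<and> y \<in> carrier R \<and> x \<noteq> y \<and> x \<oplus>\<^bsub>R\<^esub> y \<in> Units R})"

text \<open>A graph has one incidence matrix for each ordering of its vertices and of its edges,
  hence a predicate; \<open>vs\<close> and \<open>es\<close> are these orderings.\<close>

definition incidence_matrix :: "'v graph \<Rightarrow> 'a::zero_neq_one mat \<Rightarrow> bool" where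
  "incidence_matrix G H \<longleftrightarrow>
     (\<exists>vs es. distinct vs \<and> set vs = fst G \<and> distinct es \<and> set es = snd G \<and>
        H = mat (length vs) (length es) (\<lambda>(i, j). if vs ! i \<in> es ! j then 1 else 0))"

definition generated_code :: "'a::field mat \<Rightarrow> 'a vec set" where
  "generated_code H = vec_space.row_space (dim_col H) H"

definition dual_code :: "nat \<Rightarrow> 'a::field vec set \<Rightarrow> 'a vec set" where
  "dual_code N C = vec_module.orthogonal_complement N C"

definition hamming_weight :: "'a::zero vec \<Rightarrow> nat" where
  "hamming_weight v = card {i. i < dim_vec v \<and> v $ i \<noteq> 0}"

text \<open>An \<open>[N, k, d]\<^sub>q\<close> code; the alphabet, the field with \<open>q\<close> elements, is the type \<open>'a\<close>.\<close>

definition linear_code :: "nat \<Rightarrow> nat \<Rightarrow> nat \<Rightarrow> 'a::field vec set \<Rightarrow> bool" where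
  "linear_code N k d C \<longleftrightarrow>
     VectorSpace.subspace class_ring C (module_vec TYPE('a) N) \<and>
     vectorspace.dim class_ring ((module_vec TYPE('a) N)\<lparr>carrier := C\<rparr>) = k \<and>
     (\<exists>v\<in>C. v \<noteq> 0\<^sub>v N \<and> hamming_weight v = d) \<and>
     (\<forall>v\<in>C. v \<noteq> 0\<^sub>v N \<longrightarrow> d \<le> hamming_weight v)"

text \<open>The type \<open>'q mod_ring\<close> is the ring of integers modulo \<open>CARD('q)\<close>, a field if \<open>'q\<close> has
  class \<open>prime_card\<close>, i.e. if \<open>CARD('q)\<close> is prime. The type \<open>bool\<close> has two elements.\<close>

type_synonym gf2 = "bool mod_ring"

end

theory Submission
  imports Defs "Jordan_Normal_Form.Matrix_Kernel"
begin

text \<open>The dual of the row space of an incidence matrix \<open>H\<close> is the kernel of \<open>H\<close>, i.e. the space of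
  edge weightings whose sum vanishes at every vertex. The image of \<open>H\<close> is the hyperplane
  orthogonal to a sign function \<open>s\<close> with \<open>s x + s y = 0\<close> on every edge: \<open>s = 1\<close> in characteristic
  2, and \<open>s = \<plusminus>1\<close> according to parity if \<open>n\<close> is even. So \<open>H\<close> has rank \<open>n - 1\<close>, and rank-nullity
  and an edge count give the dimension. A nonzero weighting in the kernel has no leaf in its
  support, so the support contains a cycle: at least 3 edges, and at least 4 if the graph is
  bipartite. Equality is attained by a triangle \<open>0, 1, y\<close> and by a quadrangle \<open>0, 1, t, -1\<close>.\<close>

section \<open>Kernels of matrices\<close>

lemma linear_map_mult_mat_vec:
  fixes A :: "'a::field mat"
  assumes A: "A \<in> carrier_mat nr nc"
  shows "linear_map class_ring (module_vec TYPE('a) nc) (module_vec TYPE('a) nr) ((*\<^sub>v) A)"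
proof -
  interpret NC: vec_space "TYPE('a)" nc .
  interpret NR: vec_space "TYPE('a)" nr .
  have "(*\<^sub>v) A \<in> LinearCombinations.module_hom class_ring NC.V NR.V"
    unfolding LinearCombinations.module_hom_def using A mult_add_distrib_mat_vec[OF A] mult_mat_vec[OF A]
    by (simp add: module_vec_simps)
  then show ?thesis
    by unfold_locales
qed

lemma mat_kernel_eq_ker:
  fixes A :: "'a::field mat"
  assumes A: "A \<in> carrier_mat nr nc"
  shows "mod_hom.ker (module_vec TYPE('a) nc) (module_vec TYPE('a) nr) ((*\<^sub>v) A) = mat_kernel A"
proof -
  interpret linear_map class_ring "module_vec TYPE('a) nc" "module_vec TYPE('a) nr" "(*\<^sub>v) A"
    using A by (rule linear_map_mult_mat_vec)
  show ?thesis
    unfolding ker_def using A by (auto simp: mat_kernel_def module_vec_simps)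
qed

text \<open>The rank enters as the dimension of the image, because the image of an incidence matrix
  can be described explicitly; the dimension of the kernel then follows.\<close>

lemma mat_rank_nullity:
  fixes A :: "'a::field mat"
  assumes A: "A \<in> carrier_mat nr nc"
  shows "vectorspace.dim class_ring ((module_vec TYPE('a) nr)\<lparr>carrier := (*\<^sub>v) A ` carrier_vec nc\<rparr>)
    + vectorspace.dim class_ring ((module_vec TYPE('a) nc)\<lparr>carrier := mat_kernel A\<rparr>) = nc"
proof -
  interpret NC: vec_space "TYPE('a)" nc .
  interpret T: linear_map class_ring NC.V "module_vec TYPE('a) nr" "(*\<^sub>v) A"
    using A by (rule linear_map_mult_mat_vec)
  have "T.imT = (*\<^sub>v) A ` carrier_vec nc"
    by (simp add: T.im_def)
  then show ?thesis
    using T.rank_nullity NC.fin_dim NC.dim_is_n mat_kernel_eq_ker[OF A] by simp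
qed

lemma mat_kernel_subspace:
  fixes A :: "'a::field mat"
  assumes A: "A \<in> carrier_mat nr nc"
  shows "VectorSpace.subspace class_ring (mat_kernel A) (module_vec TYPE('a) nc)"
proof -
  interpret linear_map class_ring "module_vec TYPE('a) nc" "module_vec TYPE('a) nr" "(*\<^sub>v) A"
    using A by (rule linear_map_mult_mat_vec)
  show ?thesis
    using kerT_is_subspace mat_kernel_eq_ker[OF A] by simp
qed

text \<open>A vector is orthogonal to a span as soon as it is orthogonal to the spanning rows, and
  its products with the rows are the coordinates of its image under \<open>H\<close>.\<close>

lemma dual_code_eq_mat_kernel:
  fixes H :: "'a::field mat"
  shows "dual_code (dim_col H) (generated_code H) = mat_kernel H"
proof -
  interpret vec_space "TYPE('a)" "dim_col H" .
  have "set (rows H) \<subseteq> carrier_vec (dim_col H)"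
    by (auto simp: rows_def)
  then have "orthogonal_complement (row_space H) = orthogonal_complement (set (rows H))"
    by (simp add: row_space_def)
  also have "\<dots> = mat_kernel H"
  proof -
    have "(\<forall>y\<in>set (rows H). x \<bullet> y = 0) \<longleftrightarrow> H *\<^sub>v x = 0\<^sub>v (dim_row H)"
      if x: "x \<in> carrier_vec (dim_col H)" for x
    proof -
      have "(\<forall>y\<in>set (rows H). x \<bullet> y = 0) \<longleftrightarrow> (\<forall>i<dim_row H. x \<bullet> row H i = 0)"
        by (auto simp: set_conv_nth)
      also have "\<dots> \<longleftrightarrow> (\<forall>i<dim_row H. row H i \<bullet> x = 0)"
        using x by (metis comm_scalar_prod row_carrier)
      also have "\<dots> \<longleftrightarrow> H *\<^sub>v x = 0\<^sub>v (dim_row H)"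
        by (auto simp: vec_eq_iff)
      finally show ?thesis .
    qed
    then show ?thesis
      unfolding orthogonal_complement_def mat_kernel_def by blast
  qed
  finally show ?thesis
    by (simp add: dual_code_def generated_code_def)
qed

text \<open>A nonzero functional is onto the one-dimensional space, so rank-nullity for the matrix
  with the single row \<open>s\<close> leaves a kernel of dimension \<open>n - 1\<close>.\<close>

lemma dim_hyperplane:
  fixes s :: "'a::field vec"
  assumes s: "s \<in> carrier_vec n" and i: "i < n" "s $ i \<noteq> 0"
  shows "vectorspace.dim class_ring
    ((module_vec TYPE('a) n)\<lparr>carrier := {w \<in> carrier_vec n. s \<bullet> w = 0}\<rparr>) = n - 1"
proof -
  let ?S = "mat 1 n (\<lambda>(i, j). s $ j)"
  have S: "?S \<in> carrier_mat 1 n"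
    by simp
  have Sv: "?S *\<^sub>v w = vec 1 (\<lambda>_. s \<bullet> w)" if "w \<in> carrier_vec n" for w
  proof (rule eq_vecI)
    have "row ?S 0 = s"
      using s by (intro eq_vecI) auto
    then show "(?S *\<^sub>v w) $ i = vec 1 (\<lambda>_. s \<bullet> w) $ i" if "i < dim_vec (vec 1 (\<lambda>_. s \<bullet> w))" for i
      using that by simp
  qed simp
  have im: "(*\<^sub>v) ?S ` carrier_vec n = carrier_vec 1"
  proof (intro equalityI subsetI)
    fix y :: "'a vec"
    assume y: "y \<in> carrier_vec 1"
    \<comment> \<open>Surjectivity: a multiple of the unit vector at a coordinate where
      \<open>s\<close> does not vanish takes any prescribed value.\<close>
    let ?w = "(y $ 0 / s $ i) \<cdot>\<^sub>v unit_vec n i"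
    have w: "?w \<in> carrier_vec n" by simp
    have "s \<bullet> ?w = y $ 0"
      using s i by simp
    then have "?S *\<^sub>v ?w = y"
      unfolding Sv[OF w] using y by (intro eq_vecI) auto
    then show "y \<in> (*\<^sub>v) ?S ` carrier_vec n"
      using w by (metis image_eqI)
  next
    fix y :: "'a vec"
    assume "y \<in> (*\<^sub>v) ?S ` carrier_vec n"
    then show "y \<in> carrier_vec 1"
      by (rule imageE) (simp only: mult_mat_vec_carrier[OF S])
  qed
  have ker: "mat_kernel ?S = {w \<in> carrier_vec n. s \<bullet> w = 0}"
  proof -
    have "?S *\<^sub>v w = 0\<^sub>v 1 \<longleftrightarrow> s \<bullet> w = 0" if "w \<in> carrier_vec n" for w
      unfolding Sv[OF that] by (auto simp: vec_eq_iff)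
    then show ?thesis
      unfolding mat_kernel[OF S] by blast
  qed
  have "(module_vec TYPE('a) 1)\<lparr>carrier := carrier_vec 1\<rparr> = module_vec TYPE('a) 1"
    by (simp only: module_vec_def module.simps partial_object.simps)
  then have "vectorspace.dim class_ring ((module_vec TYPE('a) 1)\<lparr>carrier := carrier_vec 1\<rparr>) = 1"
    by (simp only: vec_space.dim_is_n)
  with mat_rank_nullity[OF S] show ?thesis
    unfolding im ker by linarith
qed

section \<open>Boundaries of edge weightings\<close>

text \<open>The unsigned boundary map of a graph. It is the action of the incidence matrix, freed
  from the orderings of vertices and edges.\<close>

definition boundary :: "'v set set \<Rightarrow> ('v set \<Rightarrow> 'a::field) \<Rightarrow> 'v \<Rightarrow> 'a" where
  "boundary E g x = (\<Sum>e | e \<in> E \<and> x \<in> e. g e)"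

lemma boundary_add: "boundary E (\<lambda>e. g e + h e) x = boundary E g x + boundary E h x"
  by (simp add: boundary_def sum.distrib)

lemma boundary_diff: "boundary E (\<lambda>e. g e - h e) x = boundary E g x - boundary E h x"
  by (simp add: boundary_def sum_subtractf)

lemma boundary_scale: "boundary E (\<lambda>e. c * g e) x = c * boundary E g x"
  by (simp add: boundary_def sum_distrib_left)

lemma boundary_sum: "boundary E (\<lambda>e. \<Sum>i\<in>A. g i e) x = (\<Sum>i\<in>A. boundary E (g i) x)"
  unfolding boundary_def by (rule sum.swap)

lemma boundary_single:
  assumes "finite E" "d \<in> E"
  shows "boundary E (\<lambda>e. of_bool (e = d)) x = of_bool (x \<in> d)"
proof -
  have "boundary E (\<lambda>e. of_bool (e = d)) x = (\<Sum>e\<in>E. if e = d then of_bool (x \<in> d) else 0)"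
    unfolding boundary_def using assms(1) by (intro sum.mono_neutral_cong_left) auto
  then show ?thesis
    using assms by simp
qed

locale simple_graph =
  fixes V :: "'v set" and E :: "'v set set"
  assumes finite_V: "finite V"
    and edgeE: "e \<in> E \<Longrightarrow> \<exists>x y. x \<in> V \<and> y \<in> V \<and> x \<noteq> y \<and> e = {x, y}"
begin

lemma finite_E: "finite E"
proof (rule finite_subset)
  show "E \<subseteq> Pow V" using edgeE by blast
qed (use finite_V in simp)

lemma edge_through:
  assumes "e \<in> E" "x \<in> e"
  obtains y where "y \<in> V" "x \<in> V" "x \<noteq> y" "e = {x, y}"
proof -
  obtain a b where "a \<in> V" "b \<in> V" "a \<noteq> b" "e = {a, b}"
    using edgeE assms(1) by blast
  then show thesis
    using assms(2) that[of a] that[of b] by (auto simp: insert_commute)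
qed

text \<open>Each edge has two distinct endpoints and so arises from exactly two ordered pairs.
  Ordered pairs are what the residue count below delivers.\<close>

lemma handshake: "card {(x, y). {x, y} \<in> E} = 2 * card E"
proof -
  have "{(x, y). {x, y} \<in> E} = (\<Union>e\<in>E. {(x, y). {x, y} = e})"
    by blast
  also have "card \<dots> = (\<Sum>e\<in>E. card {(x, y). {x, y} = e})"
  proof (rule card_UN_disjoint)
    show "\<forall>e\<in>E. finite {(x, y). {x, y} = e}"
    proof
      fix e assume "e \<in> E"
      then have "e \<subseteq> V"
        using edgeE by blast
      then have "{(x, y). {x, y} = e} \<subseteq> V \<times> V"
        by auto
      then show "finite {(x, y). {x, y} = e}"
        using finite_V finite_subset by blast
    qed
  qed (use finite_E in auto)
  also have "\<dots> = (\<Sum>e\<in>E. 2)"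
  proof (rule sum.cong)
    fix e assume "e \<in> E"
    then obtain a b where "a \<noteq> b" "e = {a, b}"
      using edgeE by blast
    then have "{(x, y). {x, y} = e} = {(a, b), (b, a)}" "(a, b) \<noteq> (b, a)"
      by (auto simp: doubleton_eq_iff)
    then show "card {(x, y). {x, y} = e} = 2"
      by simp
  qed simp
  finally show ?thesis by simp
qed

section \<open>Lower bounds for the support of a weighting with zero boundary\<close>

lemma finite_support: "finite {e \<in> E. g e \<noteq> 0}"
  using finite_E by simp

text \<open>If \<open>e\<close> were the only support edge at \<open>x\<close>, the boundary at
  \<open>x\<close> would be \<open>g e\<close>, which is not zero.\<close>

lemma support_no_leaf:
  assumes "boundary E g x = 0" "e \<in> E" "g e \<noteq> 0" "x \<in> e"
  shows "\<exists>f\<in>E. x \<in> f \<and> f \<noteq> e \<and> g f \<noteq> 0"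
proof (rule ccontr)
  assume "\<not> ?thesis"
  then have "boundary E g x = (\<Sum>f\<in>{e}. g f)"
    unfolding boundary_def using assms finite_E by (intro sum.mono_neutral_right) auto
  with assms show False by simp
qed

text \<open>Start from \<open>e\<close> and leave first \<open>x\<close>, then \<open>z\<close>, by
  a further support edge, which exists as there are no leaves. Of \<open>h\<close> only the end
  \<open>z\<close> is recorded: its other end may be \<open>y\<close>, closing a triangle.\<close>

lemma support_path:
  assumes g: "\<forall>x\<in>V. boundary E g x = 0" and e: "e \<in> E" "g e \<noteq> 0"
  obtains x y z f h where "e = {x, y}" "f = {x, z}" "z \<in> h" "f \<noteq> h" "x \<noteq> y" "y \<noteq> z" "x \<noteq> z"
    "f \<in> E" "g f \<noteq> 0" "h \<in> E" "g h \<noteq> 0" "y \<in> V"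
proof -
  obtain x y where xy: "x \<in> V" "y \<in> V" "x \<noteq> y" "e = {x, y}"
    using edgeE e by blast
  obtain f where f: "f \<in> E" "x \<in> f" "f \<noteq> e" "g f \<noteq> 0"
    using support_no_leaf[of g x e] g e xy by auto
  obtain z where z: "z \<in> V" "x \<noteq> z" "f = {x, z}"
    using edge_through f by blast
  obtain h where "h \<in> E" "z \<in> h" "h \<noteq> f" "g h \<noteq> 0"
    using support_no_leaf[of g z f] g f z by auto
  with that xy f z show thesis by blast
qed

text \<open>The edges of the path \<open>e\<close>, \<open>f\<close>, \<open>h\<close> are distinct,
  since \<open>z\<close> lies on \<open>f\<close> and \<open>h\<close> but not on
  \<open>e\<close>.\<close>

lemma card_support_ge_3:
  assumes g: "\<forall>x\<in>V. boundary E g x = 0" and e: "e \<in> E" "g e \<noteq> 0"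
  shows "3 \<le> card {e \<in> E. g e \<noteq> 0}"
proof -
  obtain x y z f h where *: "e = {x, y}" "f = {x, z}" "z \<in> h" "f \<noteq> h" "x \<noteq> y" "y \<noteq> z" "x \<noteq> z"
    "f \<in> E" "g f \<noteq> 0" "h \<in> E" "g h \<noteq> 0"
    using support_path[OF g e] by metis
  have "z \<notin> e"
    using *(1,6,7) by simp
  moreover have "z \<in> f"
    using *(2) by simp
  ultimately have "e \<noteq> f" "e \<noteq> h"
    using *(3) by metis+
  then have c: "card {e, f, h} = 3"
    using *(4) by simp
  have "{e, f, h} \<subseteq> {e \<in> E. g e \<noteq> 0}"
    using *(8-11) e by simp
  from card_mono[OF finite_support this] c show ?thesis
    by simp
qed

text \<open>The path \<open>y\<close>, \<open>x\<close>, \<open>z\<close> is prolonged at both ends,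
  by \<open>h\<close> at \<open>z\<close> and by \<open>k\<close> at \<open>y\<close>. If these were
  the same edge, it would join \<open>y\<close> and \<open>z\<close> and close a triangle.\<close>

lemma card_support_ge_4:
  assumes g: "\<forall>x\<in>V. boundary E g x = 0" and e: "e \<in> E" "g e \<noteq> 0"
    and no_triangle: "\<And>x y z. {x, y} \<in> E \<Longrightarrow> {y, z} \<in> E \<Longrightarrow> {x, z} \<notin> E"
  shows "4 \<le> card {e \<in> E. g e \<noteq> 0}"
proof -
  obtain x y z f h where *: "e = {x, y}" "f = {x, z}" "z \<in> h" "f \<noteq> h" "x \<noteq> y" "y \<noteq> z" "x \<noteq> z"
    "f \<in> E" "g f \<noteq> 0" "h \<in> E" "g h \<noteq> 0" "y \<in> V"
    using support_path[OF g e] by metis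
  obtain k where k: "k \<in> E" "y \<in> k" "k \<noteq> e" "g k \<noteq> 0"
    using support_no_leaf[of g y e] g e * by auto
  have "k \<noteq> h"
  proof
    assume "k = h"
    obtain w where "h = {z, w}"
      using edge_through * by metis
    then have "h = {y, z}"
      using \<open>k = h\<close> k * by auto
    then show False
      using no_triangle[of x y z] * e by auto
  qed
  moreover have "e \<noteq> f" "e \<noteq> h" "k \<noteq> f"
  proof -
    have "z \<notin> e"
      using *(1,6,7) by simp
    moreover have "z \<in> f" "y \<notin> f"
      using *(2,5,6) by simp_all
    ultimately show "e \<noteq> f" "e \<noteq> h" "k \<noteq> f"
      using *(3) k(2) by metis+
  qed
  ultimately have c: "card {e, f, h, k} = 4"
    using *(4) k(3) by (simp add: eq_commute)
  have "{e, f, h, k} \<subseteq> {e \<in> E. g e \<noteq> 0}"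
    using *(8-11) e k by simp
  from card_mono[OF finite_support this] c show ?thesis
    by simp
qed

section \<open>Short cycles as weightings with zero boundary\<close>

lemma triangle_cycle:
  assumes E: "{a, b} \<in> E" "{b, c} \<in> E" "{a, c} \<in> E" and d: "a \<noteq> b" "b \<noteq> c" "a \<noteq> c"
    and char_2: "(1::'a::field) + 1 = 0"
  obtains g :: "'v set \<Rightarrow> 'a::field" where "\<And>x. boundary E g x = 0" "card {e \<in> E. g e \<noteq> 0} = 3"
proof
  define g :: "'v set \<Rightarrow> 'a" where
    "g e = of_bool (e = {a, b}) + of_bool (e = {b, c}) + of_bool (e = {a, c})" for e
  \<comment> \<open>Every vertex of the triangle lies on exactly two of its edges, and the two ones
    cancel in characteristic 2.\<close>
  show "boundary E g x = 0" for x
    unfolding g_def boundary_add using E finite_E d char_2 by (simp add: boundary_single)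
  have "{e \<in> E. g e \<noteq> 0} = {{a, b}, {b, c}, {a, c}}"
    using E d by (auto simp: g_def doubleton_eq_iff)
  then show "card {e \<in> E. g e \<noteq> 0} = 3"
    using d by (simp add: doubleton_eq_iff)
qed

text \<open>Signs that alternate around an even cycle cancel at each vertex over any field.\<close>

lemma quadrangle_cycle:
  assumes E: "{a, b} \<in> E" "{b, c} \<in> E" "{c, d} \<in> E" "{d, a} \<in> E"
    and d: "a \<noteq> b" "a \<noteq> c" "a \<noteq> d" "b \<noteq> c" "b \<noteq> d" "c \<noteq> d"
  obtains g :: "'v set \<Rightarrow> 'a::field" where "\<And>x. boundary E g x = 0" "card {e \<in> E. g e \<noteq> 0} = 4"
proof
  define g :: "'v set \<Rightarrow> 'a" where
    "g e = (of_bool (e = {a, b}) + of_bool (e = {c, d})) - (of_bool (e = {b, c}) + of_bool (e = {d, a}))"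
    for e
  show "boundary E g x = 0" for x
    unfolding g_def boundary_add boundary_diff using E finite_E d by (auto simp: boundary_single)
  have "{e \<in> E. g e \<noteq> 0} = {{a, b}, {b, c}, {c, d}, {d, a}}"
    using E d by (auto simp: g_def doubleton_eq_iff)
  then show "card {e \<in> E. g e \<noteq> 0} = 4"
    using d by (simp add: doubleton_eq_iff)
qed

end

section \<open>Incidence matrices\<close>

text \<open>Once the two orderings are fixed, vectors correspond to functions on vertices or on
  edges, and statements about \<open>H\<close> become statements about
  \<open>boundary\<close>.\<close>

locale incidence = simple_graph V E
  for V :: "'v set" and E :: "'v set set" +
  fixes vs :: "'v list" and es :: "'v set list" and H :: "'a::field mat"
  assumes vs: "distinct vs" "set vs = V"
    and es: "distinct es" "set es = E"
    and H: "H = mat (length vs) (length es) (\<lambda>(i, j). if vs ! i \<in> es ! j then 1 else 0)"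
begin

definition vertex_vec :: "('v \<Rightarrow> 'a) \<Rightarrow> 'a vec" where
  "vertex_vec f = vec (length vs) (\<lambda>i. f (vs ! i))"

definition edge_vec :: "('v set \<Rightarrow> 'a) \<Rightarrow> 'a vec" where
  "edge_vec g = vec (length es) (\<lambda>j. g (es ! j))"

lemma H_carrier: "H \<in> carrier_mat (length vs) (length es)"
  by (simp add: H)

lemma length_vs: "length vs = card V"
  using distinct_card[OF vs(1)] vs(2) by simp

lemma length_es: "length es = card E"
  using distinct_card[OF es(1)] es(2) by simp

lemma vec_nth_surj:
  assumes "distinct xs" "v \<in> carrier_vec (length xs)"
  shows "\<exists>f. v = vec (length xs) (\<lambda>i. f (xs ! i))"
proof
  \<comment> \<open>The function looks up the index of an entry; this index is unique because the
    entries are distinct.\<close>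
  show "v = vec (length xs) (\<lambda>i. (\<lambda>x. v $ (inv_into {..<length xs} ((!) xs) x)) (xs ! i))"
  proof (rule eq_vecI)
    fix i
    assume i: "i < dim_vec (vec (length xs) (\<lambda>i. v $ (inv_into {..<length xs} ((!) xs) (xs ! i))))"
    then have "inv_into {..<length xs} ((!) xs) (xs ! i) = i"
      using assms(1) by (intro inv_into_f_f) (auto simp: inj_on_nth)
    then show "v $ i = vec (length xs) (\<lambda>i. v $ (inv_into {..<length xs} ((!) xs) (xs ! i))) $ i"
      using i by simp
  qed (use assms(2) in simp)
qed

lemma sum_nth_vs: "(\<Sum>i<length vs. f (vs ! i)) = (\<Sum>x\<in>V. f x)"
  by (rule sum.reindex_bij_betw[OF bij_betw_nth[OF vs(1) refl vs(2)[symmetric]], of f])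

lemma sum_nth_es: "(\<Sum>j<length es. f (es ! j)) = (\<Sum>e\<in>E. f e)"
  by (rule sum.reindex_bij_betw[OF bij_betw_nth[OF es(1) refl es(2)[symmetric]], of f])

lemma mult_edge_vec: "H *\<^sub>v edge_vec g = vertex_vec (boundary E g)"
proof (rule eq_vecI)
  fix i
  assume "i < dim_vec (vertex_vec (boundary E g))"
  then have i: "i < length vs" by (simp add: vertex_vec_def)
  have "(H *\<^sub>v edge_vec g) $ i = (\<Sum>j<length es. if vs ! i \<in> es ! j then g (es ! j) else 0)"
    using i by (auto simp: H edge_vec_def scalar_prod_def atLeast0LessThan intro!: sum.cong)
  also have "\<dots> = (\<Sum>e\<in>E. if vs ! i \<in> e then g e else 0)"
    by (rule sum_nth_es)
  also have "\<dots> = boundary E g (vs ! i)"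
    unfolding boundary_def using finite_E by (simp add: sum.If_cases Int_def)
  finally show "(H *\<^sub>v edge_vec g) $ i = vertex_vec (boundary E g) $ i"
    using i by (simp add: vertex_vec_def)
qed (simp add: H vertex_vec_def)

lemma vertex_vec_eq_iff: "vertex_vec f = vertex_vec h \<longleftrightarrow> (\<forall>x\<in>V. f x = h x)"
  unfolding vs(2)[symmetric] all_set_conv_all_nth by (simp add: vertex_vec_def vec_eq_iff)

lemma edge_vec_eq_iff: "edge_vec f = edge_vec h \<longleftrightarrow> (\<forall>x\<in>E. f x = h x)"
  unfolding es(2)[symmetric] all_set_conv_all_nth by (simp add: edge_vec_def vec_eq_iff)

lemma edge_vec_in_kernel_iff: "edge_vec g \<in> mat_kernel H \<longleftrightarrow> (\<forall>x\<in>V. boundary E g x = 0)"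
proof -
  have "0\<^sub>v (length vs) = vertex_vec (\<lambda>_. 0)"
    by (auto simp: vertex_vec_def)
  then show ?thesis
    using mat_kernel[OF H_carrier] mult_edge_vec[of g] vertex_vec_eq_iff[of "boundary E g" "\<lambda>_. 0"]
    by (simp add: edge_vec_def)
qed

lemma hamming_weight_edge_vec: "hamming_weight (edge_vec g) = card {e \<in> E. g e \<noteq> 0}"
proof -
  have "bij_betw ((!) es) {i. i < length es \<and> g (es ! i) \<noteq> 0} {e \<in> E. g e \<noteq> 0}"
    using es by (auto simp: bij_betw_def inj_on_def nth_eq_iff_index_eq in_set_conv_nth)
  moreover have "{i. i < dim_vec (edge_vec g) \<and> edge_vec g $ i \<noteq> 0}
      = {i. i < length es \<and> g (es ! i) \<noteq> 0}"
    by (auto simp: edge_vec_def)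
  ultimately show ?thesis
    unfolding hamming_weight_def by (simp add: bij_betw_same_card)
qed

text \<open>The image of \<open>H\<close> is the hyperplane orthogonal to \<open>s\<close>.
  Boundaries lie in it because \<open>s\<close> cancels on the ends of every edge; they fill it
  because the functions in the premise \<open>image\<close> span it. The result is an addition,
  which avoids truncated subtraction.\<close>

lemma dim_kernel:
  fixes s :: "'v \<Rightarrow> 'a"
  assumes sign: "\<And>x y. {x, y} \<in> E \<Longrightarrow> s x + s y = 0"
    and r: "r \<in> V" "s r = 1"
    and image: "\<And>x. x \<in> V \<Longrightarrow> \<exists>g. \<forall>y\<in>V. boundary E g y = of_bool (y = x) - s x * of_bool (y = r)"
  shows "vectorspace.dim class_ring
    ((module_vec TYPE('a) (length es))\<lparr>carrier := mat_kernel H\<rparr>) + (card V - 1) = card E"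
proof -
  let ?s = "vertex_vec s"
  have s_prod: "?s \<bullet> vertex_vec f = (\<Sum>x\<in>V. s x * f x)" for f
    using sum_nth_vs[of "\<lambda>x. s x * f x"]
    by (simp add: scalar_prod_def vertex_vec_def atLeast0LessThan)
  have s_boundary: "(\<Sum>x\<in>V. s x * boundary E g x) = 0" for g
  proof -
    have "(\<Sum>x\<in>V. s x * boundary E g x) = (\<Sum>x\<in>V. \<Sum>e\<in>E. if x \<in> e then s x * g e else 0)"
      unfolding boundary_def sum_distrib_left
      using finite_E by (simp add: sum.If_cases Int_def)
    \<comment> \<open>Summed edge by edge, each edge contributes its weight times the sum of
      \<open>s\<close> over its two ends, which is zero.\<close>
    also have "\<dots> = (\<Sum>e\<in>E. \<Sum>x\<in>V. if x \<in> e then s x * g e else 0)"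
      by (rule sum.swap)
    also have "\<dots> = 0"
    proof (rule sum.neutral, rule ballI)
      fix e
      assume e: "e \<in> E"
      then obtain x y where xy: "x \<in> V" "y \<in> V" "x \<noteq> y" "e = {x, y}"
        using edgeE by blast
      have "(\<Sum>x\<in>V. if x \<in> e then s x * g e else 0) = (\<Sum>x\<in>{x, y}. s x * g e)"
        using finite_V xy by (intro sum.mono_neutral_cong_right) auto
      also have "\<dots> = (s x + s y) * g e"
        using xy(3) by (simp add: ring_distribs)
      also have "\<dots> = 0"
        using sign[of x y] e xy(4) by simp
      finally show "(\<Sum>x\<in>V. if x \<in> e then s x * g e else 0) = 0" .
    qed
    finally show ?thesis .
  qed
  have im: "(*\<^sub>v) H ` carrier_vec (length es) = {w \<in> carrier_vec (length vs). ?s \<bullet> w = 0}"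
  proof (intro equalityI subsetI)
    fix w
    assume "w \<in> (*\<^sub>v) H ` carrier_vec (length es)"
    then obtain v where v: "v \<in> carrier_vec (length es)" "w = H *\<^sub>v v"
      by (rule imageE)
    obtain g where "v = edge_vec g"
      using vec_nth_surj[OF es(1) v(1)] unfolding edge_vec_def by metis
    then have "w = vertex_vec (boundary E g)"
      using v(2) mult_edge_vec by simp
    then show "w \<in> {w \<in> carrier_vec (length vs). ?s \<bullet> w = 0}"
      using s_prod s_boundary by (simp add: vertex_vec_def)
  next
    fix w
    assume w: "w \<in> {w \<in> carrier_vec (length vs). ?s \<bullet> w = 0}"
    then have "w \<in> carrier_vec (length vs)"
      by simp
    from vec_nth_surj[OF vs(1) this] obtain f where f: "w = vertex_vec f"
      unfolding vertex_vec_def by metis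
    have f0: "(\<Sum>x\<in>V. s x * f x) = 0"
      using w unfolding f s_prod[symmetric] by simp
    obtain G where G: "\<And>x y. x \<in> V \<Longrightarrow> y \<in> V \<Longrightarrow>
        boundary E (G x) y = of_bool (y = x) - s x * of_bool (y = r)"
      using image by metis
    \<comment> \<open>With the coefficients \<open>f x\<close>, the spanning functions add up to
      \<open>f\<close> minus the sum of all \<open>s x * f x\<close> placed at \<open>r\<close>, and
      this sum is zero on the hyperplane.\<close>
    let ?g = "\<lambda>e. \<Sum>x\<in>V. f x * G x e"
    have "boundary E ?g y = f y" if y: "y \<in> V" for y
    proof -
      have "boundary E ?g y = (\<Sum>x\<in>V. f x * (of_bool (y = x) - s x * of_bool (y = r)))"
        unfolding boundary_sum boundary_scale using G y by (intro sum.cong) auto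
      also have "\<dots> = (\<Sum>x\<in>V. f x * of_bool (y = x)) - (\<Sum>x\<in>V. s x * f x) * of_bool (y = r)"
        by (simp add: sum_subtractf sum_distrib_right algebra_simps)
      also have "\<dots> = (\<Sum>x\<in>V. if y = x then f x else 0)"
        unfolding f0 by (auto intro: sum.cong)
      also have "\<dots> = f y"
        using y finite_V by simp
      finally show ?thesis .
    qed
    then have "w = H *\<^sub>v edge_vec ?g"
      unfolding mult_edge_vec f vertex_vec_eq_iff by simp
    then show "w \<in> (*\<^sub>v) H ` carrier_vec (length es)"
      by (rule image_eqI) (simp add: edge_vec_def)
  qed
  have "vectorspace.dim class_ring ((module_vec TYPE('a) (length vs))
      \<lparr>carrier := {w \<in> carrier_vec (length vs). ?s \<bullet> w = 0}\<rparr>) = length vs - 1"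
  proof -
    obtain i where "i < length vs" "vs ! i = r"
      using r(1) vs(2) by (metis in_set_conv_nth)
    then show ?thesis
      using r(2) by (intro dim_hyperplane) (auto simp: vertex_vec_def)
  qed
  from mat_rank_nullity[OF H_carrier, unfolded im this] show ?thesis
    unfolding length_vs length_es by linarith
qed

text \<open>Reduces the code parameters to statements about weightings. A positive \<open>d\<close>
  guarantees that the weighting attaining it gives a nonzero word; the edge \<open>e\<close> in
  \<open>bound\<close> is the witness that a word is nonzero.\<close>

lemma linear_code_kernel:
  assumes dim: "vectorspace.dim class_ring
      ((module_vec TYPE('a) (length es))\<lparr>carrier := mat_kernel H\<rparr>) = k"
    and N: "card E = N"
    and attained: "\<exists>g::'v set \<Rightarrow> 'a. (\<forall>x. boundary E g x = 0) \<and> card {e \<in> E. g e \<noteq> 0} = d"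
    and d: "0 < d"
    and bound: "\<And>(g::'v set \<Rightarrow> 'a) e. \<forall>x\<in>V. boundary E g x = 0 \<Longrightarrow> e \<in> E \<Longrightarrow> g e \<noteq> 0 \<Longrightarrow>
      d \<le> card {e \<in> E. g e \<noteq> 0}"
  shows "linear_code N k d (dual_code (dim_col H) (generated_code H))"
proof -
  have N': "length es = N"
    using N length_es by simp
  have zero: "0\<^sub>v (length es) = edge_vec (\<lambda>_. 0)"
    by (auto simp: edge_vec_def)
  obtain g :: "'v set \<Rightarrow> 'a" where g: "\<forall>x. boundary E g x = 0" "card {e \<in> E. g e \<noteq> 0} = d"
    using attained by blast
  have "\<exists>v\<in>mat_kernel H. v \<noteq> 0\<^sub>v N \<and> hamming_weight v = d"
  proof (intro bexI conjI)
    show "edge_vec g \<in> mat_kernel H"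
      using g(1) by (simp add: edge_vec_in_kernel_iff)
    show "hamming_weight (edge_vec g) = d"
      using g(2) by (simp add: hamming_weight_edge_vec)
    have "{e \<in> E. g e \<noteq> 0} \<noteq> {}"
      using g(2) d by (metis card.empty less_numeral_extra(3))
    then show "edge_vec g \<noteq> 0\<^sub>v N"
      unfolding N'[symmetric] zero edge_vec_eq_iff by blast
  qed
  moreover have "d \<le> hamming_weight v" if v: "v \<in> mat_kernel H" "v \<noteq> 0\<^sub>v N" for v
  proof -
    have "v \<in> carrier_vec (length es)"
      using v(1) mat_kernel_carrier[OF H_carrier] by blast
    then obtain h where h: "v = edge_vec h"
      using vec_nth_surj[OF es(1)] unfolding edge_vec_def by metis
    obtain e where "e \<in> E" "h e \<noteq> 0"
      using v(2) unfolding h N'[symmetric] zero edge_vec_eq_iff by blast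
    then show ?thesis
      using bound[of h e] v(1) by (simp add: h edge_vec_in_kernel_iff hamming_weight_edge_vec)
  qed
  ultimately show ?thesis
    unfolding linear_code_def dual_code_eq_mat_kernel N'[symmetric]
    using mat_kernel_subspace[OF H_carrier] dim by (intro conjI ballI impI)
qed

end

section \<open>Unit graphs\<close>

text \<open>The sum is left unreduced in the integers, since coprimality to \<open>n\<close> depends
  only on the residue class.\<close>

definition unit_edges :: "nat \<Rightarrow> int set set" where
  "unit_edges n = {{x, y} | x y. x \<in> {0..<int n} \<and> y \<in> {0..<int n} \<and> x \<noteq> y \<and> coprime (x + y) (int n)}"

lemma unit_graph_residue_ring:
  assumes "1 < n"
  shows "unit_graph (residue_ring (int n)) = ({0..<int n}, unit_edges n)"
proof -
  interpret residues "int n" "residue_ring (int n)"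
    using assms by unfold_locales auto
  have "x \<oplus>\<^bsub>residue_ring (int n)\<^esub> y \<in> Units (residue_ring (int n)) \<longleftrightarrow> coprime (x + y) (int n)" for x y
  proof -
    \<comment> \<open>The units of the residue ring are described as positive representatives, so
      the residue 0 has to be excluded; this is where \<open>1 < n\<close> enters.\<close>
    have "0 < (x + y) mod int n" if "coprime (x + y) (int n)"
    proof -
      have "(x + y) mod int n \<noteq> 0"
        using that assms by auto
      moreover have "0 \<le> (x + y) mod int n"
        using assms by simp
      ultimately show ?thesis by linarith
    qed
    then show ?thesis
      using assms unfolding res_units_eq res_add_eq by (auto simp: coprime_mod_left_iff)
  qed
  moreover have "carrier (residue_ring (int n)) = {0..<int n}"
    by (auto simp: res_carrier_eq)
  ultimately show ?thesis
    by (simp add: unit_graph_def unit_edges_def)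
qed

lemma unit_edges_iff:
  "{x, y} \<in> unit_edges n \<longleftrightarrow>
    x \<in> {0..<int n} \<and> y \<in> {0..<int n} \<and> x \<noteq> y \<and> coprime (x + y) (int n)"
proof
  assume "{x, y} \<in> unit_edges n"
  then obtain a b where "{x, y} = {a, b}" "a \<in> {0..<int n}" "b \<in> {0..<int n}" "a \<noteq> b"
    "coprime (a + b) (int n)"
    unfolding unit_edges_def by blast
  then show "x \<in> {0..<int n} \<and> y \<in> {0..<int n} \<and> x \<noteq> y \<and> coprime (x + y) (int n)"
    by (auto simp: doubleton_eq_iff add.commute)
qed (auto simp: unit_edges_def)

text \<open>Lets vertices be named by arbitrary integers, such as \<open>- 1\<close> or
  \<open>1 - k\<close>.\<close>

lemma mod_in_unit_edges:
  assumes "0 < n" "x mod int n \<noteq> y mod int n" "coprime (x + y) (int n)"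
  shows "{x mod int n, y mod int n} \<in> unit_edges n"
proof -
  have "coprime (x mod int n + y mod int n) (int n)"
    using assms by (metis coprime_mod_left_iff mod_add_eq of_nat_0_eq_iff less_numeral_extra(3))
  then show ?thesis
    using assms by (simp add: unit_edges_iff)
qed

lemma simple_graph_unit_edges: "simple_graph {0..<int n} (unit_edges n)"
  by unfold_locales (auto simp: unit_edges_def)

section \<open>Counting the edges of a unit graph\<close>

lemma card_units_mod:
  assumes "1 < n"
  shows "card {u \<in> {0..<int n}. coprime u (int n)} = totient n"
proof -
  have "{u \<in> {0..<int n}. coprime u (int n)} = int ` totatives n"
  proof (intro equalityI subsetI)
    fix u
    assume u: "u \<in> {u \<in> {0..<int n}. coprime u (int n)}"
    then have "u = int (nat u)"
      by simp
    moreover have "nat u \<in> totatives n"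
    proof -
      have "u \<noteq> 0" using u assms by auto
      moreover have "coprime (nat u) n"
        using u \<open>u = int (nat u)\<close> by (metis (mono_tags, lifting) coprime_int_iff mem_Collect_eq)
      ultimately show ?thesis
        using u by (auto simp: totatives_def)
    qed
    ultimately show "u \<in> int ` totatives n"
      by blast
  next
    fix u
    assume "u \<in> int ` totatives n"
    then show "u \<in> {u \<in> {0..<int n}. coprime u (int n)}"
      using assms totatives_less by (auto simp: in_totatives_iff)
  qed
  then show ?thesis
    by (simp add: card_image totient_def)
qed

text \<open>Translation by \<open>x\<close> permutes the residues, so it puts these \<open>y\<close>
  in bijection with the units.\<close>

lemma card_unit_translates:
  assumes "1 < n"
  shows "card {y \<in> {0..<int n}. coprime (x + y) (int n)} = totient n"
proof -
  have "bij_betw (\<lambda>y. (x + y) mod int n) {y \<in> {0..<int n}. coprime (x + y) (int n)}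
    {u \<in> {0..<int n}. coprime u (int n)}"
  proof (rule bij_betwI[where g = "\<lambda>u. (u - x) mod int n"])
    show "(\<lambda>y. (x + y) mod int n) \<in> {y \<in> {0..<int n}. coprime (x + y) (int n)} \<rightarrow>
        {u \<in> {0..<int n}. coprime u (int n)}"
      using assms by (auto simp: coprime_mod_left_iff)
    show "(\<lambda>u. (u - x) mod int n) \<in> {u \<in> {0..<int n}. coprime u (int n)} \<rightarrow>
        {y \<in> {0..<int n}. coprime (x + y) (int n)}"
    proof (intro funcsetI CollectI conjI)
      fix u
      assume u: "u \<in> {u \<in> {0..<int n}. coprime u (int n)}"
      have "(x + (u - x) mod int n) mod int n = u mod int n"
        by (simp add: mod_simps)
      then have "coprime ((x + (u - x) mod int n) mod int n) (int n)"
        using u by simp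
      then show "coprime (x + (u - x) mod int n) (int n)"
        using assms by (subst (asm) coprime_mod_left_iff) auto
    qed (use assms in auto)
  qed (auto simp: mod_simps)
  then show ?thesis
    using card_units_mod[OF assms] by (simp add: bij_betw_same_card)
qed

text \<open>Pairs with equal entries are still included; how many of them there are depends on the
  parity of \<open>n\<close>.\<close>

lemma card_unit_pairs:
  assumes "1 < n"
  shows "card {(x, y). x \<in> {0..<int n} \<and> y \<in> {0..<int n} \<and> coprime (x + y) (int n)} = n * totient n"
proof -
  have "{(x, y). x \<in> {0..<int n} \<and> y \<in> {0..<int n} \<and> coprime (x + y) (int n)}
    = (SIGMA x:{0..<int n}. {y \<in> {0..<int n}. coprime (x + y) (int n)})"
    by auto
  also have "card \<dots> = (\<Sum>x\<in>{0..<int n}. card {y \<in> {0..<int n}. coprime (x + y) (int n)})"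
    by (rule card_SigmaI) (auto intro: finite_subset[of _ "{0..<int n}"])
  also have "\<dots> = n * totient n"
    unfolding card_unit_translates[OF assms] by simp
  finally show ?thesis .
qed

lemma coprime_even_imp_odd:
  fixes a b :: int
  assumes "coprime a b" "even b"
  shows "odd a"
  using assms coprime_common_divisor[of a b 2] by auto

lemma card_unit_edges_even:
  assumes "1 < n" "even n"
  shows "2 * card (unit_edges n) = n * totient n"
proof -
  have "\<not> coprime (x + x) (int n)" for x
    using coprime_even_imp_odd[of "x + x" "int n"] assms(2) by auto
  then have "{(x, y). {x, y} \<in> unit_edges n}
      = {(x, y). x \<in> {0..<int n} \<and> y \<in> {0..<int n} \<and> coprime (x + y) (int n)}"
    by (auto simp: unit_edges_iff)
  then show ?thesis
    using simple_graph.handshake[OF simple_graph_unit_edges, of n] card_unit_pairs[OF assms(1)]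
    by simp
qed

lemma card_unit_edges_odd:
  assumes "1 < n" "odd n"
  shows "2 * card (unit_edges n) = (n - 1) * totient n"
proof -
  let ?P = "{(x, y). x \<in> {0..<int n} \<and> y \<in> {0..<int n} \<and> coprime (x + y) (int n)}"
  let ?D = "(\<lambda>x. (x, x)) ` {u \<in> {0..<int n}. coprime u (int n)}"
  have double: "coprime (x + x) (int n) \<longleftrightarrow> coprime x (int n)" for x
  proof -
    have "coprime 2 (int n)"
      using assms(2) by simp
    then show ?thesis
      by (simp flip: mult_2)
  qed
  have "{(x, y). {x, y} \<in> unit_edges n} = ?P - ?D"
    unfolding unit_edges_iff using double by blast
  moreover have "card (?P - ?D) = card ?P - card ?D"
  proof (rule card_Diff_subset)
    show "finite ?D"
      by (intro finite_imageI finite_subset[OF _ finite_atLeastLessThan_int[of 0 "int n"]]) auto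
    show "?D \<subseteq> ?P"
      using double by blast
  qed
  moreover have "card ?D = totient n"
    using card_units_mod[OF assms(1)] by (simp add: card_image inj_on_def)
  ultimately have "card {(x, y). {x, y} \<in> unit_edges n} = n * totient n - totient n"
    using card_unit_pairs[OF assms(1)] by simp
  then show ?thesis
    using simple_graph.handshake[OF simple_graph_unit_edges, of n] by (simp add: algebra_simps)
qed

text \<open>Two points \<open>x\<close> and \<open>x + 1\<close> (\<open>n\<close> odd), or \<open>x\<close> and \<open>x + 2\<close> (\<open>n\<close> even), have a common neighbour,
  so their signed difference is a boundary. Chaining such differences links every vertex to \<open>0\<close>.\<close>

definition is_boundary :: "nat \<Rightarrow> (int \<Rightarrow> 'a::field) \<Rightarrow> bool" where
  "is_boundary n f \<longleftrightarrow> (\<exists>g. \<forall>x\<in>{0..<int n}. boundary (unit_edges n) g x = f x)"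

definition point :: "nat \<Rightarrow> int \<Rightarrow> int \<Rightarrow> 'a::field" where
  "point n x y = of_bool (y = x mod int n)"

lemma is_boundary_zero: "is_boundary n (\<lambda>_. 0)"
  unfolding is_boundary_def by (rule exI[of _ "\<lambda>_. 0"]) (simp add: boundary_def)

lemma is_boundary_add:
  assumes "is_boundary n f" "is_boundary n g"
  shows "is_boundary n (\<lambda>y. f y + g y)"
proof -
  obtain a b where "\<forall>x\<in>{0..<int n}. boundary (unit_edges n) a x = f x"
    "\<forall>x\<in>{0..<int n}. boundary (unit_edges n) b x = g x"
    using assms unfolding is_boundary_def by blast
  then show ?thesis
    unfolding is_boundary_def by (intro exI[of _ "\<lambda>e. a e + b e"]) (simp add: boundary_add)
qed

lemma is_boundary_diff:
  assumes "is_boundary n f" "is_boundary n g"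
  shows "is_boundary n (\<lambda>y. f y - g y)"
proof -
  obtain a b where "\<forall>x\<in>{0..<int n}. boundary (unit_edges n) a x = f x"
    "\<forall>x\<in>{0..<int n}. boundary (unit_edges n) b x = g x"
    using assms unfolding is_boundary_def by blast
  then show ?thesis
    unfolding is_boundary_def by (intro exI[of _ "\<lambda>e. a e - b e"]) (simp add: boundary_diff)
qed

lemma is_boundary_edge:
  assumes "0 < n" "x mod int n \<noteq> y mod int n" "coprime (x + y) (int n)"
  shows "is_boundary n (\<lambda>z. point n x z + point n y z)"
proof -
  let ?d = "{x mod int n, y mod int n}"
  have "boundary (unit_edges n) (\<lambda>e. of_bool (e = ?d)) z = point n x z + point n y z" for z
    unfolding point_def using assms(2)
    by (subst boundary_single[OF simple_graph.finite_E[OF simple_graph_unit_edges]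
          mod_in_unit_edges[OF assms]]) auto
  then show ?thesis
    unfolding is_boundary_def by blast
qed

lemma is_boundary_point_char_2:
  assumes n: "1 < n" "odd n" and char_2: "(1::'a::field) + 1 = 0"
  shows "is_boundary n (\<lambda>z. point n (int k) z - point n 0 z :: 'a)"
proof (induction k)
  case 0
  then show ?case
    using is_boundary_zero by simp
next
  case (Suc k)
  have edge: "is_boundary n (\<lambda>z. point n x z + point n y z :: 'a)" if "coprime (x + y) (int n)" for x y
  proof (cases "x mod int n = y mod int n")
    case True
    then have "(\<lambda>z. point n x z + point n y z :: 'a) = (\<lambda>_. 0)"
      using char_2 by (auto simp: point_def)
    then show ?thesis
      using is_boundary_zero by metis
  next
    case False
    then show ?thesis
      using that n(1) by (intro is_boundary_edge) auto
  qed
  have "is_boundary n (\<lambda>z. point n (int k) z + point n (1 - int k) z :: 'a)"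
    by (rule edge) simp
  moreover have "is_boundary n (\<lambda>z. point n (int (Suc k)) z + point n (1 - int k) z :: 'a)"
    by (rule edge) (use n in simp)
  ultimately have "is_boundary n (\<lambda>z. ((point n (int (Suc k)) z + point n (1 - int k) z)
      - (point n (int k) z + point n (1 - int k) z)) + (point n (int k) z - point n 0 z) :: 'a)"
    by (intro is_boundary_add[OF is_boundary_diff Suc.IH])
  then show ?case
    by (simp add: algebra_simps)
qed

lemma is_boundary_point_even:
  assumes n: "1 < n" "even n"
  shows "is_boundary n (\<lambda>z. point n (int k) z - (if even k then 1 else - 1) * point n 0 z :: 'a::field)"
proof (induction k rule: induct_nat_012)
  have edge: "is_boundary n (\<lambda>z. point n x z + point n y z :: 'a)" if c: "coprime (x + y) (int n)" for x y
  proof (rule is_boundary_edge)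
    show "x mod int n \<noteq> y mod int n"
    proof
      assume "x mod int n = y mod int n"
      then have "int n dvd x - y"
        by (simp add: mod_eq_dvd_iff)
      then have "even (x - y)"
        using n(2) by (meson dvd_trans even_of_nat)
      then have "even (x + y)"
        by simp
      then show False
        using coprime_even_imp_odd[OF c] n(2) by simp
    qed
  qed (use n c in auto)
  {
    case 0
    then show ?case
      using is_boundary_zero by simp
  next
    case 1
    have "is_boundary n (\<lambda>z. point n 1 z + point n 0 z :: 'a)"
      by (rule edge) simp
    then show ?case
      by simp
  next
    case (ge2 k)
    have "is_boundary n (\<lambda>z. point n (int k) z + point n (- 1 - int k) z :: 'a)"
      by (rule edge) simp
    moreover have "is_boundary n (\<lambda>z. point n (int (Suc (Suc k))) z + point n (- 1 - int k) z :: 'a)"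
      by (rule edge) simp
    ultimately have "is_boundary n (\<lambda>z. ((point n (int (Suc (Suc k))) z + point n (- 1 - int k) z)
        - (point n (int k) z + point n (- 1 - int k) z))
        + (point n (int k) z - (if even k then 1 else - 1) * point n 0 z) :: 'a)"
      by (intro is_boundary_add[OF is_boundary_diff ge2.IH(1)])
    then show ?case
      by (simp add: algebra_simps)
  }
qed

lemma is_boundaryD:
  fixes c :: "'a::field"
  assumes "is_boundary n (\<lambda>z. point n x z - c * point n 0 z)" "x \<in> {0..<int n}"
  shows "\<exists>g. \<forall>y\<in>{0..<int n}. boundary (unit_edges n) g y = of_bool (y = x) - c * of_bool (y = 0)"
  using assms by (auto simp: is_boundary_def point_def)

lemma incidence_unit_graph:
  assumes "1 < n" "incidence_matrix (unit_graph (residue_ring (int n))) H"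
  obtains vs es where "incidence {0..<int n} (unit_edges n) vs es H"
proof -
  obtain vs es where "distinct vs" "set vs = {0..<int n}" "distinct es" "set es = unit_edges n"
    "H = mat (length vs) (length es) (\<lambda>(i, j). if vs ! i \<in> es ! j then 1 else 0)"
    using assms(2) unfolding incidence_matrix_def unit_graph_residue_ring[OF assms(1)] by auto
  then have "incidence {0..<int n} (unit_edges n) vs es H"
    by (intro incidence.intro simple_graph_unit_edges) (unfold_locales, auto)
  with that show thesis .
qed

lemma totient_even_pos:
  assumes "2 < n"
  obtains k where "totient n = 2 * k" "0 < k"
proof -
  have "even (totient n)" "0 < totient n"
    using assms by (auto intro: totient_even)
  then show thesis
    using that by (metis dvdE zero_less_mult_pos gr0I mult_0_right less_numeral_extra(3))
qed

lemma linear_code_unit_graph_odd: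
  fixes H :: "'a::field mat"
  assumes n: "1 < n" "odd n" and char_2: "(1::'a) + 1 = 0"
    and H: "incidence_matrix (unit_graph (residue_ring (int n))) H"
    and y: "y mod int n \<noteq> 0" "y mod int n \<noteq> 1" "coprime y (int n)" "coprime (1 + y) (int n)"
  shows "linear_code ((n - 1) * totient n div 2) ((n - 1) * (totient n - 2) div 2) 3
    (dual_code (dim_col H) (generated_code H))"
proof -
  obtain vs es where "incidence {0..<int n} (unit_edges n) vs es H"
    using incidence_unit_graph n(1) H .
  then interpret incidence "{0..<int n}" "unit_edges n" vs es H .
  have "2 < n"
    using n by (cases "n = 2") auto
  then obtain k where k: "totient n = 2 * k" "0 < k"
    by (rule totient_even_pos)
  then have N: "card (unit_edges n) = (n - 1) * k"
    using card_unit_edges_odd[OF n] by simp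
  show ?thesis
  proof (rule linear_code_kernel)
    have "vectorspace.dim class_ring
        ((module_vec TYPE('a) (length es))\<lparr>carrier := mat_kernel H\<rparr>) + (card {0..<int n} - 1)
      = card (unit_edges n)"
    proof (rule dim_kernel[where s = "\<lambda>_. 1" and r = 0])
      fix x
      assume x: "x \<in> {0..<int n}"
      then have "is_boundary n (\<lambda>z. point n x z - 1 * point n 0 z :: 'a)"
        using is_boundary_point_char_2[OF n char_2, of "nat x"] by simp
      then show "\<exists>g. \<forall>y\<in>{0..<int n}.
          boundary (unit_edges n) g y = of_bool (y = x) - (1::'a) * of_bool (y = 0)"
        using x by (rule is_boundaryD)
    qed (use n char_2 in auto)
    then have "vectorspace.dim class_ring
        ((module_vec TYPE('a) (length es))\<lparr>carrier := mat_kernel H\<rparr>) = (n - 1) * k - (n - 1)"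
      unfolding N by simp
    also have "\<dots> = (n - 1) * (totient n - 2) div 2"
      unfolding k(1) using diff_mult_distrib2[of "n - 1" "2 * k" 2] by (simp add: diff_mult_distrib2 div_mult2_eq flip: mult.assoc)
    finally show "vectorspace.dim class_ring
        ((module_vec TYPE('a) (length es))\<lparr>carrier := mat_kernel H\<rparr>) = (n - 1) * (totient n - 2) div 2" .
    show "card (unit_edges n) = (n - 1) * totient n div 2"
      using N k(1) by simp
    have "{0, 1} \<in> unit_edges n" "{1, y mod int n} \<in> unit_edges n" "{0, y mod int n} \<in> unit_edges n"
      using mod_in_unit_edges[of n 0 1] mod_in_unit_edges[of n 0 y] mod_in_unit_edges[of n 1 y] y n
      by auto
    then obtain g :: "int set \<Rightarrow> 'a"
      where "\<And>x. boundary (unit_edges n) g x = 0" "card {e \<in> unit_edges n. g e \<noteq> 0} = 3"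
      by (rule triangle_cycle) (use y char_2 in auto)
    then show "\<exists>g::int set \<Rightarrow> 'a. (\<forall>x. boundary (unit_edges n) g x = 0) \<and>
        card {e \<in> unit_edges n. g e \<noteq> 0} = 3"
      by blast
  qed (use card_support_ge_3 in auto)
qed

lemma linear_code_unit_graph_even:
  fixes H :: "'a::field mat"
  assumes n: "2 < n" "even n"
    and H: "incidence_matrix (unit_graph (residue_ring (int n))) H"
    and t: "1 < t" "t + 1 < int n" "coprime (t + 1) (int n)" "coprime (t - 1) (int n)"
  shows "linear_code (n * totient n div 2) ((n * (totient n - 2) + 2) div 2) 4
    (dual_code (dim_col H) (generated_code H))"
proof -
  have n1: "1 < n" using n by simp
  obtain vs es where "incidence {0..<int n} (unit_edges n) vs es H"
    using incidence_unit_graph n1 H .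
  then interpret incidence "{0..<int n}" "unit_edges n" vs es H .
  obtain k where k: "totient n = 2 * k" "0 < k"
    using n(1) by (rule totient_even_pos)
  then have N: "card (unit_edges n) = n * k"
    using card_unit_edges_even[OF n1 n(2)] by simp
  have odd_edge: "odd (x + y)" if "{x, y} \<in> unit_edges n" for x y
    using that n(2) coprime_even_imp_odd[of "x + y" "int n"] by (simp add: unit_edges_iff)
  show ?thesis
  proof (rule linear_code_kernel)
    have "vectorspace.dim class_ring
        ((module_vec TYPE('a) (length es))\<lparr>carrier := mat_kernel H\<rparr>) + (card {0..<int n} - 1)
      = card (unit_edges n)"
    proof (rule dim_kernel[where s = "\<lambda>x. if even x then 1 else - 1" and r = 0])
      fix x
      assume x: "x \<in> {0..<int n}"
      then have "is_boundary n (\<lambda>z. point n x z - (if even x then 1 else - 1) * point n 0 z :: 'a)"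
        using is_boundary_point_even[OF n1 n(2), of "nat x"] by (simp add: even_nat_iff)
      then show "\<exists>g. \<forall>y\<in>{0..<int n}. boundary (unit_edges n) g y
          = of_bool (y = x) - (if even x then 1 else - (1::'a)) * of_bool (y = 0)"
        using x by (rule is_boundaryD)
    next
      fix x y
      assume "{x, y} \<in> unit_edges n"
      then show "(if even x then 1 else - 1) + (if even y then 1 else - 1) = (0::'a)"
        using odd_edge by auto
    qed (use n in auto)
    then have "vectorspace.dim class_ring
        ((module_vec TYPE('a) (length es))\<lparr>carrier := mat_kernel H\<rparr>) = n * k - (n - 1)"
      unfolding N by simp
    also have "\<dots> = (n * (totient n - 2) + 2) div 2"
    proof -
      obtain j where "k = Suc j"
        using k(2) gr0_implies_Suc by blast
      then show ?thesis
        using n1 unfolding k(1) by simp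
    qed
    finally show "vectorspace.dim class_ring
        ((module_vec TYPE('a) (length es))\<lparr>carrier := mat_kernel H\<rparr>)
      = (n * (totient n - 2) + 2) div 2" .
    show "card (unit_edges n) = n * totient n div 2"
      using N k(1) by simp
    have minus_1: "- 1 mod int n = int n - 1"
      using n1 by (simp add: zmod_minus1)
    have "{0, 1} \<in> unit_edges n" "{1, t} \<in> unit_edges n" "{t, int n - 1} \<in> unit_edges n"
      "{int n - 1, 0} \<in> unit_edges n"
      using mod_in_unit_edges[of n 0 1] mod_in_unit_edges[of n 1 t] mod_in_unit_edges[of n t "- 1"]
        mod_in_unit_edges[of n "- 1" 0] t n unfolding minus_1 by (auto simp: add.commute)
    then obtain g :: "int set \<Rightarrow> 'a"
      where "\<And>x. boundary (unit_edges n) g x = 0" "card {e \<in> unit_edges n. g e \<noteq> 0} = 4"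
      by (rule quadrangle_cycle) (use t n in auto)
    then show "\<exists>g::int set \<Rightarrow> 'a. (\<forall>x. boundary (unit_edges n) g x = 0) \<and>
        card {e \<in> unit_edges n. g e \<noteq> 0} = 4"
      by blast
    fix g :: "int set \<Rightarrow> 'a" and e
    assume "\<forall>x\<in>{0..<int n}. boundary (unit_edges n) g x = 0" "e \<in> unit_edges n" "g e \<noteq> 0"
    then show "4 \<le> card {e \<in> unit_edges n. g e \<noteq> 0}"
    proof (rule card_support_ge_4)
      fix x y z
      assume "{x, y} \<in> unit_edges n" "{y, z} \<in> unit_edges n"
      then show "{x, z} \<notin> unit_edges n"
        using odd_edge[of x y] odd_edge[of y z] odd_edge[of x z] by auto
    qed
  qed simp
qed

lemma exists_unit_triangle:
  fixes p q :: nat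
  assumes "prime p" "odd p" "prime q" "odd q" "p \<noteq> q" "q \<noteq> 3" "n = p ^ a * q ^ b" "1 \<le> b"
  obtains y :: int where "y mod int n \<noteq> 0" "y mod int n \<noteq> 1" "coprime y (int n)" "coprime (1 + y) (int n)"
proof -
  have p: "3 \<le> p"
    using assms(1,2) prime_ge_2_nat[of p] by (cases "p = 2") auto
  have q: "3 < q"
    using assms(3,4,6) prime_ge_2_nat[of q] by (cases "q = 2") auto
  obtain y where y: "[y = 1] (mod p)" "[y = 2] (mod q)"
    using binary_chinese_remainder_nat[of p q 1 2] assms(1,3,5) primes_coprime by blast
  have y_mod: "y mod p = 1" "y mod q = 2"
    using y p q by (simp_all add: cong_def)
  have Suc_mod: "Suc y mod p = 2" "Suc y mod q = 3"
    using y_mod p q by (simp_all add: mod_Suc)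
  have "\<not> p dvd y" "\<not> q dvd y" "\<not> p dvd Suc y" "\<not> q dvd Suc y"
    using y_mod Suc_mod by (simp_all add: dvd_eq_mod_eq_0)
  then have "coprime p y" "coprime q y" "coprime p (Suc y)" "coprime q (Suc y)"
    using assms(1,3) prime_imp_coprime by blast+
  then have "coprime y n" "coprime (Suc y) n"
    unfolding assms(7) by (simp_all add: coprime_commute)
  then have c: "coprime (int y) (int n)" "coprime (1 + int y) (int n)"
    using coprime_int_iff[of "Suc y" n] by simp_all
  have "y mod n mod q = 2"
    using assms(7,8) y_mod(2) by (simp add: mod_mod_cancel dvd_power)
  moreover have "0 mod q \<noteq> 2" "1 mod q \<noteq> 2"
    using q by simp_all
  ultimately have "y mod n \<noteq> 0" "y mod n \<noteq> 1"
    by metis+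
  then have "int y mod int n \<noteq> 0" "int y mod int n \<noteq> 1"
    by (simp_all flip: of_nat_mod)
  with c show thesis
    using that by blast
qed

lemma exists_unit_quadrangle:
  fixes p :: nat
  assumes "prime p" "odd p" "1 \<le> m" "1 \<le> a" "n = 2 ^ m * p ^ a" "n \<noteq> 6"
  obtains t :: int where "1 < t" "t + 1 < int n" "coprime (t + 1) (int n)" "coprime (t - 1) (int n)"
proof -
  have p3: "3 \<le> p"
    using assms(1,2) prime_ge_2_nat[of p] by (cases "p = 2") auto
  have dvd: "2 * p dvd n"
    unfolding assms(5) using assms(3,4) by (intro mult_dvd_mono) (auto simp: dvd_power)
  have n0: "0 < n"
    using assms(5) p3 by simp
  show thesis
  proof (cases "p = 3")
    case True
    obtain c where c: "n = 6 * c"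
      using dvd True by auto
    have "c \<noteq> 0" "c \<noteq> 1"
      using c n0 assms(6) by auto
    then have "12 \<le> n"
      using c by simp
    moreover have "coprime (7::nat) 3" "coprime (5::nat) 3" "coprime (7::nat) 2" "coprime (5::nat) 2"
      by (simp_all add: coprime_iff_gcd_eq_1 gcd_non_0_nat)
    then have "coprime 7 n" "coprime 5 n"
      unfolding assms(5) True by simp_all
    then have "coprime (7::int) (int n)" "coprime (5::int) (int n)"
      using coprime_int_iff[of 7 n] coprime_int_iff[of 5 n] by simp_all
    ultimately show thesis
      by (intro that[of 6]) auto
  next
    case False
    have "3 < p"
      using p3 False by simp
    then have "6 < n"
      using dvd_imp_le[OF dvd n0] by linarith
    moreover have "coprime p 3"
      using primes_coprime[OF assms(1), of 3] False by simp
    then have "coprime 3 n"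
      unfolding assms(5) by (simp add: coprime_commute)
    then have "coprime (3::int) (int n)"
      using coprime_int_iff[of 3 n] by simp
    ultimately show thesis
      by (intro that[of 2]) auto
  qed
qed

theorem corollary4p9:
  "(\<forall>(p1::nat) (p2::nat) (n1::nat) (n2::nat) (n::nat) (H :: gf2 mat).
      prime p1 \<and> odd p1 \<and> prime p2 \<and> odd p2 \<and> p1 \<noteq> p2 \<and> n1 \<ge> 1 \<and> n2 \<ge> 1 \<and>
      n = p1 ^ n1 * p2 ^ n2 \<and>
      incidence_matrix (unit_graph (residue_ring (int n))) H \<longrightarrow>
      linear_code ((n - 1) * totient n div 2) ((n - 1) * (totient n - 2) div 2) 3
        (dual_code (dim_col H) (generated_code H)))
   \<and>
   (\<forall>(p1::nat) (m::nat) (n1::nat) (n::nat) (H :: 'q::prime_card mod_ring mat).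
      odd CARD('q) \<and>
      prime p1 \<and> odd p1 \<and> m \<ge> 1 \<and> n1 \<ge> 1 \<and> n = 2 ^ m * p1 ^ n1 \<and> n \<noteq> 6 \<and>
      incidence_matrix (unit_graph (residue_ring (int n))) H \<longrightarrow>
      linear_code (n * totient n div 2) ((n * (totient n - 2) + 2) div 2) 4
        (dual_code (dim_col H) (generated_code H)))"
proof (intro conjI allI impI; elim conjE)
  fix p1 p2 n1 n2 n :: nat and H :: "gf2 mat"
  assume *: "prime p1" "odd p1" "prime p2" "odd p2" "p1 \<noteq> p2" "1 \<le> n1" "1 \<le> n2"
    "n = p1 ^ n1 * p2 ^ n2"
    and H: "incidence_matrix (unit_graph (residue_ring (int n))) H"
  have "1 < p1 ^ n1" "1 < p2 ^ n2"
    using one_less_power[OF prime_gt_1_nat] *(1,3,6,7) by simp_all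
  then have "1 < n"
    unfolding *(8) by (rule less_1_mult)
  moreover have "odd n"
    using * by simp
  moreover have "(1::gf2) + 1 = 0"
    using of_nat_CHAR[where 'a = gf2] by simp
  moreover have "\<exists>y. y mod int n \<noteq> 0 \<and> y mod int n \<noteq> 1 \<and> coprime y (int n) \<and> coprime (1 + y) (int n)"
  proof (cases "p2 = 3")
    case False
    then show ?thesis
      using exists_unit_triangle[OF *(1-5) False *(8,7)] by metis
  next
    case True
    then have "p1 \<noteq> 3" "n = p2 ^ n2 * p1 ^ n1"
      using *(5,8) by auto
    then show ?thesis
      using exists_unit_triangle[OF *(3,4,1,2) _ _ _ *(6)] *(5) by metis
  qed
  ultimately show "linear_code ((n - 1) * totient n div 2) ((n - 1) * (totient n - 2) div 2) 3
      (dual_code (dim_col H) (generated_code H))"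
    using linear_code_unit_graph_odd[OF _ _ _ H] by blast
next
  fix p1 m n1 n :: nat and H :: "'q mod_ring mat"
  assume *: "prime p1" "odd p1" "1 \<le> m" "1 \<le> n1" "n = 2 ^ m * p1 ^ n1" "n \<noteq> 6"
    and H: "incidence_matrix (unit_graph (residue_ring (int n))) H"
  obtain t :: int where t: "1 < t" "t + 1 < int n" "coprime (t + 1) (int n)" "coprime (t - 1) (int n)"
    using exists_unit_quadrangle[OF *] .
  have "even n"
    using *(3,5) by simp
  moreover have "2 < n"
    using t(1,2) by simp
  ultimately show "linear_code (n * totient n div 2) ((n * (totient n - 2) + 2) div 2) 4
      (dual_code (dim_col H) (generated_code H))"
    using linear_code_unit_graph_even H t by blast
qed

end
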